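(* Let $\mathbf P=(P,\leq,{}')$ be a downward directed poset with a unary operation $'$ and let $\mathbb D(\mathbf P)=(P,\sqcap,{}')$ be a meet-directoid assigned to $\mathbf P$. Then $\mathbf P$ is a Kleene poset if and only if $\mathbb D(\mathbf P)$ satisfies, for all $x,y,z,w\in P$, the identities (1) $x''=x$, (2) $(x\sqcap y)'\sqcap y'=y'$, (3) $(z\sqcap x)\sqcap(z\sqcap x')\leq(w\sqcup y)\sqcup(w\sqcup y')$, and the following implication: (4) for all $x,y,z,w,s\in P$: if for all $t\in P$ one has $w\sqcap((t\sqcup x)\sqcup(t\sqcup y))=w\sqcap z=w$ and $s\sqcup((t\sqcap x)\sqcap(t\sqcap z))=s\sqcup((t\sqcap y)\sqcap(t\sqcap z))=s$, then $w\leq s$.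
   Context: Let $(P,\leq)$ be a poset. For $A,B\subseteq P$ write $A\leq B$ if $x\leq y$ for all $x\in A$, $y\in B$. Put $L(A)=\{x\in P\mid x\leq y\text{ for all }y\in A\}$ and $U(A)=\{x\in P\mid y\leq x\text{ for all }y\in A\}$. Write $L(a,b)=L(\{a,b\})$, $L(A,b)=L(A\cup\{b\})$, $L(A,B)=L(A\cup B)$, $LU(A)=L(U(A))$, and analogously for $U$. A unary operation $'$ on $P$ is antitone if $x\leq y$ implies $y'\leq x'$, and an involution if $x''=x$ for all $x$. A poset is distributive if $L(U(x,y),z)=LU(L(x,z),L(y,z))$ for all elements $x,y,z$. A pseudo-Kleene poset is a poset $(P,\leq,{}')$ with an antitone involution satisfying $L(x,x')\leq U(y,y')$ for all $x,y\in P$. A Kleene poset is a distributive pseudo-Kleene poset. A poset is downward directed if $L(x,y)\neq\emptyset$ for all $x,y$. A meet-directoid assigned to a downward directed poset $(P,\leq)$ is a groupoid $(P,\sqcap)$ such that $x\sqcap y=x\wedge y$ (the smaller of the two elements) if $x,y$ are comparable, and $x\sqcap y=y\sqcap x$ is an arbitrarily chosen element of $L(x,y)$ if $x,y$ are incomparable. One has $x\leq y$ if and only if $x\sqcap y=x$. The unary operation $'$ is carried along, and $x\sqcup y:=(x'\sqcap y')'$. *)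

theory Defs
  imports Main
begin

(* A poset is a carrier P with a relation r satisfying partial_order_on P r. Then
   Field r = P, so for A \<subseteq> P the sets L(A) and U(A) are the library's Under r A and Above r A;
   (x, y) \<in> r means x \<le> y. *)

definition set_below :: "'a rel \<Rightarrow> 'a set \<Rightarrow> 'a set \<Rightarrow> bool" where
  "set_below r A B \<longleftrightarrow> (\<forall>x\<in>A. \<forall>y\<in>B. (x, y) \<in> r)"

definition distributive_poset :: "'a set \<Rightarrow> 'a rel \<Rightarrow> bool" where
  "distributive_poset P r \<longleftrightarrow> partial_order_on P r \<and>
     (\<forall>x\<in>P. \<forall>y\<in>P. \<forall>z\<in>P.
        Under r (Above r {x, y} \<union> {z}) = Under r (Above r (Under r {x, z} \<union> Under r {y, z})))"

definition antitone_involution :: "'a set \<Rightarrow> 'a rel \<Rightarrow> ('a \<Rightarrow> 'a) \<Rightarrow> bool" where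
  "antitone_involution P r neg \<longleftrightarrow> neg ` P \<subseteq> P \<and>
     (\<forall>x\<in>P. \<forall>y\<in>P. (x, y) \<in> r \<longrightarrow> (neg y, neg x) \<in> r) \<and>
     (\<forall>x\<in>P. neg (neg x) = x)"

definition pseudo_kleene_poset :: "'a set \<Rightarrow> 'a rel \<Rightarrow> ('a \<Rightarrow> 'a) \<Rightarrow> bool" where
  "pseudo_kleene_poset P r neg \<longleftrightarrow> partial_order_on P r \<and> antitone_involution P r neg \<and>
     (\<forall>x\<in>P. \<forall>y\<in>P. set_below r (Under r {x, neg x}) (Above r {y, neg y}))"

definition kleene_poset :: "'a set \<Rightarrow> 'a rel \<Rightarrow> ('a \<Rightarrow> 'a) \<Rightarrow> bool" where
  "kleene_poset P r neg \<longleftrightarrow> distributive_poset P r \<and> pseudo_kleene_poset P r neg"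

definition downward_directed :: "'a set \<Rightarrow> 'a rel \<Rightarrow> bool" where
  "downward_directed P r \<longleftrightarrow> (\<forall>x\<in>P. \<forall>y\<in>P. Under r {x, y} \<noteq> {})"

definition assigned_meet_directoid :: "'a set \<Rightarrow> 'a rel \<Rightarrow> ('a \<Rightarrow> 'a \<Rightarrow> 'a) \<Rightarrow> bool" where
  "assigned_meet_directoid P r meet \<longleftrightarrow>
     (\<forall>x\<in>P. \<forall>y\<in>P.
        ((x, y) \<in> r \<longrightarrow> meet x y = x) \<and>
        ((y, x) \<in> r \<longrightarrow> meet x y = y) \<and>
        ((x, y) \<notin> r \<and> (y, x) \<notin> r \<longrightarrow> meet x y = meet y x \<and> meet x y \<in> Under r {x, y}))"

end

theory Submission
  imports Defs
begin

text \<open>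
  Both halves of the equivalence translate cone conditions on the poset into element conditions on
  the directoid. The bridge is that two nested meets parametrize a lower cone: as \<open>t\<close> runs
  through \<open>P\<close>, the element \<open>(t \<sqinter> x) \<sqinter> (t \<sqinter> y)\<close> runs through exactly the
  common lower bounds of \<open>x\<close> and \<open>y\<close>. It always is a common lower bound, and each common
  lower bound \<open>t\<close> is reproduced by itself, since \<open>t \<sqinter> x = t = t \<sqinter> y\<close>
  (\<open>Under_pair_eq_image\<close>). A single meet would not do: \<open>x \<sqinter> y\<close> is just one, arbitrarily
  chosen, lower bound.

  The first two identities say that the unary operation is an antitone involution
  (\<open>antitone_involution_iff_identities\<close>). Such an operation is an isomorphism of the poset onto
  its dual, which turns the De Morgan join into a meet-directoid of the dual order
  (\<open>dual_directoid\<close>). Therefore \<open>(t \<squnion> x) \<squnion> (t \<squnion> y)\<close> parametrizes the upper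
  cone of \<open>x\<close> and \<open>y\<close> in the same way.

  The inequality with four variables is then the pseudo-Kleene condition with the elements of both cones written in
  parametrized form. In a poset the inclusion of \<open>LU(L(x,z),L(y,z))\<close> in \<open>L(U(x,y),z)\<close> holds
  always, so distributivity only asks that each \<open>w\<close> in \<open>L(U(x,y),z)\<close> is below each \<open>s\<close> in
  \<open>U(L(x,z),L(y,z))\<close> (\<open>distributive_poset_iff\<close>). The final implication says this, with the memberships of
  \<open>w\<close> and \<open>s\<close> written as equations in the parameter \<open>t\<close>.
\<close>

lemma partial_order_on_FieldD:
  assumes "partial_order_on P r"
  shows "Field r = P"
  using assms unfolding partial_order_on_def preorder_on_def refl_on_def Field_def by blast

lemma mem_Under_iff:
  assumes "partial_order_on P r"
  shows "a \<in> Under r A \<longleftrightarrow> a \<in> P \<and> (\<forall>x\<in>A. (a, x) \<in> r)"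
  using partial_order_on_FieldD[OF assms] by (simp add: Under_def)

lemma mem_Above_iff:
  assumes "partial_order_on P r"
  shows "a \<in> Above r A \<longleftrightarrow> a \<in> P \<and> (\<forall>x\<in>A. (x, a) \<in> r)"
  using partial_order_on_FieldD[OF assms] by (simp add: Above_def)

lemma Under_converse: "Under (r\<inverse>) A = Above r A"
  by (simp add: Under_def Above_def)

lemma directoid_meet_Under:
  assumes "partial_order_on P r" "assigned_meet_directoid P r meet" "x \<in> P" "y \<in> P"
  shows "meet x y \<in> Under r {x, y}"
proof -
  have "(x, x) \<in> r" "(y, y) \<in> r"
    using assms(1,3,4) by (auto simp: partial_order_on_def preorder_on_def refl_on_def)
  then show ?thesis
    using assms(2-4) unfolding assigned_meet_directoid_def mem_Under_iff[OF assms(1)]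
    by (cases "(x, y) \<in> r"; cases "(y, x) \<in> r") (auto simp: mem_Under_iff[OF assms(1)])
qed

lemma directoid_le_iff:
  assumes "partial_order_on P r" "assigned_meet_directoid P r meet" "x \<in> P" "y \<in> P"
  shows "(x, y) \<in> r \<longleftrightarrow> meet x y = x"
proof
  show "(x, y) \<in> r \<Longrightarrow> meet x y = x"
    using assms by (simp add: assigned_meet_directoid_def)
  show "meet x y = x \<Longrightarrow> (x, y) \<in> r"
    using directoid_meet_Under[OF assms] by (simp add: mem_Under_iff[OF assms(1)])
qed

lemma directoid_ge_iff:
  assumes "partial_order_on P r" "assigned_meet_directoid P r meet" "x \<in> P" "y \<in> P"
  shows "(y, x) \<in> r \<longleftrightarrow> meet x y = y"
proof
  show "(y, x) \<in> r \<Longrightarrow> meet x y = y"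
    using assms by (simp add: assigned_meet_directoid_def)
  show "meet x y = y \<Longrightarrow> (y, x) \<in> r"
    using directoid_meet_Under[OF assms] by (simp add: mem_Under_iff[OF assms(1)])
qed

text \<open>
  The inner meets push \<open>t\<close> below \<open>x\<close> and below \<open>y\<close> separately, and the outer meet lies below both
  results. Nothing is changed if \<open>t\<close> already is a common lower bound, because meets of comparable
  elements are not subject to choice.
\<close>

lemma Under_pair_eq_image:
  assumes po: "partial_order_on P r" and dir: "assigned_meet_directoid P r meet"
    and x: "x \<in> P" and y: "y \<in> P"
  shows "Under r {x, y} = (\<lambda>t. meet (meet t x) (meet t y)) ` P"
proof (intro set_eqI iffI)
  fix t assume t: "t \<in> Under r {x, y}"
  then have "t \<in> P" "(t, x) \<in> r" "(t, y) \<in> r" "(t, t) \<in> r"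
    using po by (auto simp: mem_Under_iff[OF po] partial_order_on_def preorder_on_def refl_on_def)
  then have "t = meet (meet t x) (meet t y)"
    using directoid_le_iff[OF po dir] x y by simp
  then show "t \<in> (\<lambda>t. meet (meet t x) (meet t y)) ` P"
    using \<open>t \<in> P\<close> by (rule image_eqI)
next
  fix a assume "a \<in> (\<lambda>t. meet (meet t x) (meet t y)) ` P"
  then obtain t where t: "t \<in> P" and a: "a = meet (meet t x) (meet t y)" by blast
  have 1: "meet t x \<in> P" "(meet t x, x) \<in> r" "meet t y \<in> P" "(meet t y, y) \<in> r"
    using directoid_meet_Under[OF po dir t x] directoid_meet_Under[OF po dir t y]
    by (simp_all add: mem_Under_iff[OF po])
  have "a \<in> P" "(a, meet t x) \<in> r" "(a, meet t y) \<in> r"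
    using directoid_meet_Under[OF po dir 1(1,3)] by (simp_all add: a mem_Under_iff[OF po])
  moreover have "trans r" using po by (simp add: partial_order_on_def preorder_on_def)
  ultimately show "a \<in> Under r {x, y}"
    using 1 by (auto simp: mem_Under_iff[OF po] dest: transD)
qed

lemma antitone_involution_iff_identities:
  assumes po: "partial_order_on P r" and dir: "assigned_meet_directoid P r meet"
    and closed: "neg ` P \<subseteq> P"
  shows "antitone_involution P r neg \<longleftrightarrow>
    (\<forall>x\<in>P. neg (neg x) = x) \<and> (\<forall>x\<in>P. \<forall>y\<in>P. meet (neg (meet x y)) (neg y) = neg y)"
proof -
  have negP: "neg x \<in> P" if "x \<in> P" for x
    using closed that by blast
  have meet: "meet x y \<in> P" "(meet x y, y) \<in> r" if "x \<in> P" "y \<in> P" for x y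
    using directoid_meet_Under[OF po dir that] by (simp_all add: mem_Under_iff[OF po])
  \<comment> \<open>Antitonicity on pairs \<open>x \<sqinter> y \<le> y\<close> suffices, as \<open>x \<le> y\<close> means \<open>x \<sqinter> y = x\<close>.\<close>
  have "(\<forall>x\<in>P. \<forall>y\<in>P. (x, y) \<in> r \<longrightarrow> (neg y, neg x) \<in> r) \<longleftrightarrow>
      (\<forall>x\<in>P. \<forall>y\<in>P. (neg y, neg (meet x y)) \<in> r)"
    using meet directoid_le_iff[OF po dir] by metis
  also have "\<dots> \<longleftrightarrow> (\<forall>x\<in>P. \<forall>y\<in>P. meet (neg (meet x y)) (neg y) = neg y)"
    using meet negP directoid_ge_iff[OF po dir] by simp
  finally show ?thesis
    using closed by (auto simp: antitone_involution_def)
qed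

text \<open>
  An antitone involution reverses the order in both directions, hence preserves incomparability, so
  the De Morgan join of an incomparable pair is again a symmetric choice of an upper bound.
\<close>

lemma dual_directoid:
  assumes po: "partial_order_on P r" and dir: "assigned_meet_directoid P r meet"
    and anti: "antitone_involution P r neg"
    and join: "\<And>x y. x \<in> P \<Longrightarrow> y \<in> P \<Longrightarrow> join x y = neg (meet (neg x) (neg y))"
  shows "assigned_meet_directoid P (r\<inverse>) join"
proof -
  have negP: "neg x \<in> P" and inv: "neg (neg x) = x" if "x \<in> P" for x
    using anti that by (auto simp: antitone_involution_def)
  have le_neg: "(neg x, neg y) \<in> r \<longleftrightarrow> (y, x) \<in> r" if "x \<in> P" "y \<in> P" for x y
    using anti that negP inv unfolding antitone_involution_def by metis
  have comparable: "join x y = x" "join y x = x" if "x \<in> P" "y \<in> P" "(y, x) \<in> r" for x y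
    using that dir negP inv le_neg by (simp_all add: join assigned_meet_directoid_def)
  have incomparable: "join x y = join y x \<and> join x y \<in> Under (r\<inverse>) {x, y}"
    if xy: "x \<in> P" "y \<in> P" and "(x, y) \<notin> r" "(y, x) \<notin> r" for x y
  proof -
    have "(neg x, neg y) \<notin> r" "(neg y, neg x) \<notin> r" using that le_neg by auto
    then have sym: "meet (neg x) (neg y) = meet (neg y) (neg x)"
      and m: "meet (neg x) (neg y) \<in> Under r {neg x, neg y}"
      using dir negP xy unfolding assigned_meet_directoid_def by blast+
    then have mP: "meet (neg x) (neg y) \<in> P" by (simp add: mem_Under_iff[OF po])
    have "(x, join x y) \<in> r" "(y, join x y) \<in> r"
      using m le_neg[OF negP mP] inv xy
      by (simp_all add: mem_Under_iff[OF po] join)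
    then show ?thesis
      using sym negP mP xy
      by (simp add: Under_converse mem_Above_iff[OF po] join)
  qed
  show ?thesis
    unfolding assigned_meet_directoid_def using comparable incomparable by auto
qed

text \<open>
  Only one inclusion in the definition of distributivity carries content: \<open>z\<close> and every
  element of \<open>U(x,y)\<close> bound both \<open>L(x,z)\<close> and \<open>L(y,z)\<close> from above.
\<close>

lemma distributive_poset_iff:
  assumes po: "partial_order_on P r"
  shows "distributive_poset P r \<longleftrightarrow>
    (\<forall>x\<in>P. \<forall>y\<in>P. \<forall>z\<in>P. \<forall>w\<in>P. \<forall>s\<in>P.
       (\<forall>u\<in>Above r {x, y}. (w, u) \<in> r) \<and> (w, z) \<in> r \<and>
       (\<forall>l\<in>Under r {x, z}. (l, s) \<in> r) \<and> (\<forall>l\<in>Under r {y, z}. (l, s) \<in> r)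
       \<longrightarrow> (w, s) \<in> r)"
proof -
  note mem = mem_Under_iff[OF po] mem_Above_iff[OF po]
  have "trans r" using po by (simp add: partial_order_on_def preorder_on_def)
  then have easy: "Under r (Above r (Under r {x, z} \<union> Under r {y, z}))
      \<subseteq> Under r (Above r {x, y} \<union> {z})" if "z \<in> P" for x y z
  proof -
    have "Above r {x, y} \<union> {z} \<subseteq> Above r (Under r {x, z} \<union> Under r {y, z})"
      using that by (auto simp: mem) (meson \<open>trans r\<close> transD)+
    then show ?thesis
      unfolding Under_def by blast
  qed
  have subset: "Under r A \<subseteq> Under r (Above r B) \<longleftrightarrow>
      (\<forall>w\<in>P. \<forall>s\<in>P. (\<forall>a\<in>A. (w, a) \<in> r) \<and> (\<forall>b\<in>B. (b, s) \<in> r) \<longrightarrow> (w, s) \<in> r)" for A B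
    by (auto simp: subset_iff mem)
  have "distributive_poset P r \<longleftrightarrow>
      (\<forall>x\<in>P. \<forall>y\<in>P. \<forall>z\<in>P. Under r (Above r {x, y} \<union> {z})
        \<subseteq> Under r (Above r (Under r {x, z} \<union> Under r {y, z})))"
    unfolding distributive_poset_def using po easy by (simp add: set_eq_subset)
  also have "\<dots> \<longleftrightarrow> (\<forall>x\<in>P. \<forall>y\<in>P. \<forall>z\<in>P. \<forall>w\<in>P. \<forall>s\<in>P.
       (\<forall>u\<in>Above r {x, y}. (w, u) \<in> r) \<and> (w, z) \<in> r \<and>
       (\<forall>l\<in>Under r {x, z}. (l, s) \<in> r) \<and> (\<forall>l\<in>Under r {y, z}. (l, s) \<in> r)
       \<longrightarrow> (w, s) \<in> r)"
    by (simp add: subset ball_Un conj_ac)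
  finally show ?thesis .
qed

theorem theorem4p3:
  fixes P :: "'a set" and r :: "'a rel" and neg :: "'a \<Rightarrow> 'a"
    and meet :: "'a \<Rightarrow> 'a \<Rightarrow> 'a" (infixl "\<sqinter>" 70)
    and join :: "'a \<Rightarrow> 'a \<Rightarrow> 'a" (infixl "\<squnion>" 65)
  assumes poset: "partial_order_on P r"
    and directed: "downward_directed P r"
    and neg_closed: "neg ` P \<subseteq> P"
    and directoid: "assigned_meet_directoid P r (\<sqinter>)"
    and join: "\<And>x y. x \<in> P \<Longrightarrow> y \<in> P \<Longrightarrow> x \<squnion> y = neg (neg x \<sqinter> neg y)"
  shows "kleene_poset P r neg \<longleftrightarrow>
      (\<forall>x\<in>P. neg (neg x) = x) \<and>
      (\<forall>x\<in>P. \<forall>y\<in>P. neg (x \<sqinter> y) \<sqinter> neg y = neg y) \<and>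
      (\<forall>x\<in>P. \<forall>y\<in>P. \<forall>z\<in>P. \<forall>w\<in>P.
         ((z \<sqinter> x) \<sqinter> (z \<sqinter> neg x), (w \<squnion> y) \<squnion> (w \<squnion> neg y)) \<in> r) \<and>
      (\<forall>x\<in>P. \<forall>y\<in>P. \<forall>z\<in>P. \<forall>w\<in>P. \<forall>s\<in>P.
         (\<forall>t\<in>P. w \<sqinter> ((t \<squnion> x) \<squnion> (t \<squnion> y)) = w \<sqinter> z \<and> w \<sqinter> z = w \<and>
                 s \<squnion> ((t \<sqinter> x) \<sqinter> (t \<sqinter> z)) = s \<squnion> ((t \<sqinter> y) \<sqinter> (t \<sqinter> z)) \<and>
                 s \<squnion> ((t \<sqinter> y) \<sqinter> (t \<sqinter> z)) = s)
         \<longrightarrow> (w, s) \<in> r)"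
proof -
  have meetP: "a \<sqinter> b \<in> P" if "a \<in> P" "b \<in> P" for a b
    using directoid_meet_Under[OF poset directoid that] by (simp add: mem_Under_iff[OF poset])
  have conditions: "(\<forall>x\<in>P. \<forall>y\<in>P. set_below r (Under r {x, neg x}) (Above r {y, neg y})) \<longleftrightarrow>
      (\<forall>x\<in>P. \<forall>y\<in>P. \<forall>z\<in>P. \<forall>w\<in>P.
         ((z \<sqinter> x) \<sqinter> (z \<sqinter> neg x), (w \<squnion> y) \<squnion> (w \<squnion> neg y)) \<in> r)"
    (is ?kleene)
    "distributive_poset P r \<longleftrightarrow>
      (\<forall>x\<in>P. \<forall>y\<in>P. \<forall>z\<in>P. \<forall>w\<in>P. \<forall>s\<in>P.
         (\<forall>t\<in>P. w \<sqinter> ((t \<squnion> x) \<squnion> (t \<squnion> y)) = w \<sqinter> z \<and> w \<sqinter> z = w \<and>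
                 s \<squnion> ((t \<sqinter> x) \<sqinter> (t \<sqinter> z)) = s \<squnion> ((t \<sqinter> y) \<sqinter> (t \<sqinter> z)) \<and>
                 s \<squnion> ((t \<sqinter> y) \<sqinter> (t \<sqinter> z)) = s)
         \<longrightarrow> (w, s) \<in> r)"
    (is ?distributive)
    if anti: "antitone_involution P r neg"
  proof -
    have dual_poset: "partial_order_on P (r\<inverse>)"
      using poset by simp
    have dual: "assigned_meet_directoid P (r\<inverse>) (\<squnion>)"
      using dual_directoid[OF poset directoid anti] join by blast
    have joinP: "a \<squnion> b \<in> P" if "a \<in> P" "b \<in> P" for a b
      using directoid_meet_Under[OF dual_poset dual that] by (simp add: mem_Under_iff[OF dual_poset])
    note lower = Under_pair_eq_image[OF poset directoid]
    have upper: "Above r {x, y} = (\<lambda>t. (t \<squnion> x) \<squnion> (t \<squnion> y)) ` P" if "x \<in> P" "y \<in> P" for x y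
      using Under_pair_eq_image[OF dual_poset dual that] by (simp add: Under_converse)
    have le_meet: "(a, b) \<in> r \<longleftrightarrow> a \<sqinter> b = a" if "a \<in> P" "b \<in> P" for a b
      using directoid_le_iff[OF poset directoid that] .
    have le_join: "(b, a) \<in> r \<longleftrightarrow> a \<squnion> b = a" if "a \<in> P" "b \<in> P" for a b
      using directoid_le_iff[OF dual_poset dual that] by simp
    have cones: "set_below r (Under r {x, neg x}) (Above r {y, neg y}) \<longleftrightarrow>
        (\<forall>z\<in>P. \<forall>w\<in>P. ((z \<sqinter> x) \<sqinter> (z \<sqinter> neg x), (w \<squnion> y) \<squnion> (w \<squnion> neg y)) \<in> r)"
      if "x \<in> P" "y \<in> P" for x y
      using that neg_closed by (simp add: set_below_def lower upper image_subset_iff)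
    show ?kleene
      using cones by simp
    have below_upper: "(\<forall>u\<in>Above r {x, y}. (w, u) \<in> r) \<longleftrightarrow>
        (\<forall>t\<in>P. w \<sqinter> ((t \<squnion> x) \<squnion> (t \<squnion> y)) = w)" if "x \<in> P" "y \<in> P" "w \<in> P" for x y w
      using that by (simp add: upper le_meet joinP)
    have above_lower: "(\<forall>l\<in>Under r {x, z}. (l, s) \<in> r) \<longleftrightarrow>
        (\<forall>t\<in>P. s \<squnion> ((t \<sqinter> x) \<sqinter> (t \<sqinter> z)) = s)" if "x \<in> P" "z \<in> P" "s \<in> P" for x z s
      using that by (simp add: lower le_join meetP)
    have premise: "(\<forall>t\<in>P. w \<sqinter> ((t \<squnion> x) \<squnion> (t \<squnion> y)) = w \<sqinter> z \<and> w \<sqinter> z = w \<and>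
                 s \<squnion> ((t \<sqinter> x) \<sqinter> (t \<sqinter> z)) = s \<squnion> ((t \<sqinter> y) \<sqinter> (t \<sqinter> z)) \<and>
                 s \<squnion> ((t \<sqinter> y) \<sqinter> (t \<sqinter> z)) = s) \<longleftrightarrow>
       (\<forall>u\<in>Above r {x, y}. (w, u) \<in> r) \<and> (w, z) \<in> r \<and>
       (\<forall>l\<in>Under r {x, z}. (l, s) \<in> r) \<and> (\<forall>l\<in>Under r {y, z}. (l, s) \<in> r)"
      if "x \<in> P" "y \<in> P" "z \<in> P" "w \<in> P" "s \<in> P" for x y z w s
      \<comment> \<open>Dropping the quantifier over \<open>t\<close> from \<open>w \<sqinter> z = w\<close> needs some \<open>t\<close> in \<open>P\<close>, such as \<open>x\<close>.\<close>
      unfolding below_upper[OF that(1,2,4)] above_lower[OF that(1,3,5)] above_lower[OF that(2,3,5)]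
        le_meet[OF that(4,3)]
      using \<open>x \<in> P\<close> by auto
    show ?distributive
      unfolding distributive_poset_iff[OF poset] using premise by simp
  qed
  show ?thesis
    unfolding kleene_poset_def pseudo_kleene_poset_def
    using poset conditions antitone_involution_iff_identities[OF poset directoid neg_closed]
    by blast
qed

end
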